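(* Let $\alpha\ge1$, $\beta\ge1$, $m\ge1$ and $n\ge1$ be integers. Let $S_n$ be the number of white balls drawn in the first $n$ draws from a Pólya-Eggenberger urn that initially contains $\alpha$ white and $\beta$ black balls and in which each drawn ball is replaced along with $m$ additional balls of the same color, let $W_n=S_n/n$, and let $Z$ have the Beta distribution $\mathcal B(\alpha/m,\beta/m)$. Then $$d_W(W_n,Z)\ge\frac1n\,\frac{\alpha\beta}{(\alpha+\beta+m)(\alpha+\beta)}.$$
   Context: Pólya-Eggenberger urn: at time zero the urn contains $\alpha\ge1$ white and $\beta\ge1$ black balls; at every positive integer time a ball is chosen uniformly from the urn, independently of the past, and replaced along with $m\ge 1$ additional balls of the same color. For real $a,b>0$, $\mathcal B(a,b)$ is the Beta distribution on $[0,1]$ with density $x^{a-1}(1-x)^{b-1}/B(a,b)$, where $B(a,b)=\Gamma(a)\Gamma(b)/\Gamma(a+b)$. Wasserstein distance: $d_W(X,Y)=\sup_{h\in \mathrm{Lip}(1)}|\mathbb E[h(X)]-\mathbb E[h(Y)]|$, where $\mathrm{Lip}(1)=\{h:|h(x)-h(y)|\le|x-y|\}$. *)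

theory Defs
  imports "HOL-Probability.Probability"
begin

datatype colour = White | Black

text \<open>The balls of an urn holding \<open>w\<close> white and \<open>b\<close> black balls are numbered
  \<open>0, \<dots>, w + b - 1\<close>, the white ones first.\<close>

definition draw_ball :: "nat \<Rightarrow> nat \<Rightarrow> colour pmf" where
  "draw_ball w b = map_pmf (\<lambda>i. if i < w then White else Black) (pmf_of_set {..<w + b})"

text \<open>Joint law of the colours of the first \<open>n\<close> draws, in chronological order, from an urn holding
  \<open>w\<close> white and \<open>b\<close> black balls: after the first draw the process restarts from the urn with
  \<open>m\<close> more balls of the colour drawn.\<close>

primrec polya_urn_draws :: "nat \<Rightarrow> nat \<Rightarrow> nat \<Rightarrow> nat \<Rightarrow> colour list pmf" where
  "polya_urn_draws m 0 w b = return_pmf []"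
| "polya_urn_draws m (Suc n) w b =
     bind_pmf (draw_ball w b) (\<lambda>c.
       map_pmf (\<lambda>cs. c # cs)
         (case c of
            White \<Rightarrow> polya_urn_draws m n (w + m) b
          | Black \<Rightarrow> polya_urn_draws m n w (b + m)))"

definition beta_density :: "real \<Rightarrow> real \<Rightarrow> real \<Rightarrow> real" where
  "beta_density a b x =
     (if x \<in> {0..1} then x powr (a - 1) * (1 - x) powr (b - 1) / Beta a b else 0)"

text \<open>The supremum is taken in the extended reals, so that no boundedness is presupposed.  The
  expectations are Bochner integrals; the definition is meant for random variables with a finite
  first moment, for which every \<open>h \<circ> X\<close> and \<open>h \<circ> Y\<close> is integrable.\<close>

definition wasserstein_dist ::
    "'a measure \<Rightarrow> ('a \<Rightarrow> real) \<Rightarrow> 'b measure \<Rightarrow> ('b \<Rightarrow> real) \<Rightarrow> ereal" where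
  "wasserstein_dist M X N Y =
     (SUP h \<in> {h :: real \<Rightarrow> real. 1-lipschitz_on UNIV h}.
        ereal \<bar>(LINT \<omega>|M. h (X \<omega>)) - (LINT \<omega>|N. h (Y \<omega>))\<bar>)"

end

theory Submission imports Defs begin

text \<open>The value \<open>\<bar>E h(W) - E h(Z)\<bar>\<close> at a single 1-Lipschitz function \<open>h\<close> already attains the bound.
  The choice is \<open>h x = x (1 - x)\<close>: on \<open>[0, 1]\<close>, where both variables live, its derivative \<open>1 - 2 x\<close>
  has modulus at most 1, and it can be continued by 0 outside.  This particular quadratic makes
  both expectations explicit.

  Since \<open>n\<^sup>2 h(W)\<close> is the product of the numbers of white and of black draws, it counts the
  ordered pairs \<open>(i, j)\<close> such that draw \<open>i\<close> is white and draw \<open>j\<close> is black.  By exchangeability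
  each of the \<open>n (n - 1)\<close> pairs of distinct draws contributes
  \<open>q = \<alpha> \<beta> / ((\<alpha> + \<beta>) (\<alpha> + \<beta> + m))\<close>, the probability that the first draw is white and the second
  black.  Hence \<open>E h(W) = (1 - 1 / n) q\<close> (lemma \<open>expectation_white_times_black\<close>, which
  replaces exchangeability by an induction over the number of draws).

  On the other side \<open>E h(Z) = B(a + 1, b + 1) / B(a, b)\<close> with \<open>a = \<alpha> / m\<close> and \<open>b = \<beta> / m\<close>, which
  is exactly \<open>q\<close> (lemmas \<open>integral_beta_density_hump\<close> and \<open>Beta_plus1_plus1_both\<close>).
  The difference \<open>q / n\<close> is due to the \<open>n\<close> diagonal pairs among the \<open>n\<^sup>2\<close>, which contribute
  nothing because a draw cannot have both colours.\<close>

section \<open>The test function\<close>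

definition clamped_hump :: "real \<Rightarrow> real" where
  "clamped_hump x = (let y = max 0 (min 1 x) in y * (1 - y))"

lemma clamped_hump_unit_interval: "0 \<le> x \<Longrightarrow> x \<le> 1 \<Longrightarrow> clamped_hump x = x * (1 - x)"
  by (simp add: clamped_hump_def)

lemma lipschitz_clamped_hump: "1-lipschitz_on UNIV clamped_hump"
proof (rule lipschitz_onI)
  fix x y :: real
  define u where "u = max 0 (min 1 x)"
  define v where "v = max 0 (min 1 y)"
  have unit: "0 \<le> u" "u \<le> 1" "0 \<le> v" "v \<le> 1" and contraction: "\<bar>u - v\<bar> \<le> \<bar>x - y\<bar>"
    by (auto simp: u_def v_def)
  have "clamped_hump x - clamped_hump y = (u - v) * (1 - u - v)"
    by (simp add: clamped_hump_def u_def[symmetric] v_def[symmetric] Let_def algebra_simps)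
  then have "\<bar>clamped_hump x - clamped_hump y\<bar> = \<bar>u - v\<bar> * \<bar>1 - u - v\<bar>"
    by (simp add: abs_mult)
  also have "\<dots> \<le> \<bar>u - v\<bar> * 1"
    using unit by (intro mult_left_mono) auto
  finally show "dist (clamped_hump x) (clamped_hump y) \<le> 1 * dist x y"
    using contraction by (simp add: dist_real_def)
qed simp

lemma borel_measurable_clamped_hump [measurable]: "clamped_hump \<in> borel_measurable borel"
  unfolding clamped_hump_def Let_def by measurable

section \<open>The urn\<close>

lemma finite_set_pmf_polya: "0 < w + b \<Longrightarrow> finite (set_pmf (polya_urn_draws m n w b))"
proof (induction n arbitrary: w b)
  case (Suc n)
  have "finite (set_pmf (draw_ball w b))"
    using Suc.prems by (auto simp: draw_ball_def set_pmf_of_set lessThan_empty_iff)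
  then show ?case
    using Suc by (auto split: colour.split)
qed simp

lemma length_polya: "cs \<in> set_pmf (polya_urn_draws m n w b) \<Longrightarrow> length cs = n"
  by (induction n arbitrary: w b cs) (auto split: colour.splits, metis colour.exhaust)

lemma count_colours: "count_list cs White + count_list cs Black = length cs"
proof (induction cs)
  case (Cons c cs)
  then show ?case by (cases c) auto
qed simp

lemma sum_white_black:
  fixes F :: "colour \<Rightarrow> real"
  shows "(\<Sum>i<w + b. F (if i < w then White else Black)) = real w * F White + real b * F Black"
  by (induction b) (auto simp: algebra_simps)

lemma integrable_polya:
  fixes f :: "colour list \<Rightarrow> real"
  shows "0 < w + b \<Longrightarrow> integrable (measure_pmf (polya_urn_draws m n w b)) f"
  by (intro integrable_measure_pmf_finite finite_set_pmf_polya)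

lemma expectation_polya_Suc:
  fixes f :: "colour list \<Rightarrow> real"
  assumes "0 < w + b"
  shows "measure_pmf.expectation (polya_urn_draws m (Suc n) w b) f =
    (real w * measure_pmf.expectation (polya_urn_draws m n (w + m) b) (\<lambda>cs. f (White # cs)) +
     real b * measure_pmf.expectation (polya_urn_draws m n w (b + m)) (\<lambda>cs. f (Black # cs)))
    / real (w + b)"
proof -
  define P where "P c = map_pmf ((#) c) (case c of White \<Rightarrow> polya_urn_draws m n (w + m) b
     | Black \<Rightarrow> polya_urn_draws m n w (b + m))" for c
  define F where "F c = measure_pmf.expectation (P c) f" for c
  have "measure_pmf.expectation (polya_urn_draws m (Suc n) w b) f =
      measure_pmf.expectation
        (bind_pmf (pmf_of_set {..<w + b}) (\<lambda>i. P (if i < w then White else Black))) f"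
    by (simp add: draw_ball_def bind_map_pmf P_def)
  also have "\<dots> = (\<Sum>i<w + b. F (if i < w then White else Black) /\<^sub>R real (card {..<w + b}))"
    unfolding F_def using assms
    by (intro pmf_expectation_bind_pmf_of_set)
       (auto simp: P_def lessThan_empty_iff intro!: finite_set_pmf_polya)
  also have "\<dots> = (real w * F White + real b * F Black) / real (w + b)"
    by (simp add: sum_white_black divide_inverse mult.commute flip: sum_distrib_left)
  finally show ?thesis
    by (simp add: F_def P_def)
qed

text \<open>The first moments are needed for the mixed moment below: one more draw of a colour increases
  the product of the two counts by the count of the other colour.\<close>

lemma expectation_white:
  assumes "0 < w + b"
  shows "measure_pmf.expectation (polya_urn_draws m n w b) (\<lambda>cs. real (count_list cs White)) =
    real n * real w / real (w + b)"
  using assms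
proof (induction n arbitrary: w b)
  case (Suc n)
  then have pos: "real w + real b > 0" by linarith
  have white: "measure_pmf.expectation (polya_urn_draws m n (w + m) b)
      (\<lambda>cs. real (count_list (White # cs) White)) = 1 + real n * (w + m) / (w + b + m)"
  proof -
    have "0 < w + m + b" using Suc.prems by linarith
    from Suc.IH[OF this] integrable_polya[OF this] show ?thesis
      by (simp add: add_ac)
  qed
  have black: "measure_pmf.expectation (polya_urn_draws m n w (b + m))
      (\<lambda>cs. real (count_list (Black # cs) White)) = real n * w / (w + b + m)"
  proof -
    have "0 < w + (b + m)" using Suc.prems by linarith
    from Suc.IH[OF this] show ?thesis
      by (simp add: add_ac)
  qed
  have "real w * (1 + real n * (w + m) / (w + b + m)) + real b * (real n * w / (w + b + m)) =
      real (Suc n) * real w"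
    using pos by (simp add: divide_simps) algebra
  with Suc.prems show ?case
    by (subst expectation_polya_Suc) (simp_all only: white black)
qed simp

lemma expectation_black:
  assumes "0 < w + b"
  shows "measure_pmf.expectation (polya_urn_draws m n w b) (\<lambda>cs. real (count_list cs Black)) =
    real n * real b / real (w + b)"
proof -
  have "measure_pmf.expectation (polya_urn_draws m n w b) (\<lambda>cs. real (count_list cs Black)) =
      measure_pmf.expectation (polya_urn_draws m n w b) (\<lambda>cs. real n - real (count_list cs White))"
  proof (rule integral_cong_AE)
    show "AE cs in measure_pmf (polya_urn_draws m n w b).
        real (count_list cs Black) = real n - real (count_list cs White)"
    proof (rule AE_pmfI)
      fix cs assume "cs \<in> set_pmf (polya_urn_draws m n w b)"
      then have "count_list cs White + count_list cs Black = n"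
        by (simp add: count_colours length_polya)
      then show "real (count_list cs Black) = real n - real (count_list cs White)"
        by linarith
    qed
  qed simp_all
  also have "\<dots> = real n - real n * real w / real (w + b)"
    using assms by (simp add: integrable_polya expectation_white)
  also have "\<dots> = real n * real b / real (w + b)"
  proof -
    have "real (w + b) \<noteq> 0" using assms by linarith
    then show ?thesis
      by (simp add: divide_simps) (simp add: algebra_simps)
  qed
  finally show ?thesis .
qed

text \<open>Conditioning on the first draw: each colour there contributes the mean number of later draws
  of the other colour, and the later draws among themselves are covered by the induction
  hypothesis for the enlarged urn.\<close>

lemma expectation_white_times_black:
  assumes "0 < w + b"
  shows "measure_pmf.expectation (polya_urn_draws m n w b)
      (\<lambda>cs. real (count_list cs White) * real (count_list cs Black)) =
    real n * (real n - 1) * (real w * real b / (real (w + b) * real (w + b + m)))"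
  using assms
proof (induction n arbitrary: w b)
  case (Suc n)
  define s where "s = real w + real b"
  have pos: "s > 0" "s + real m > 0" "s + 2 * real m > 0"
    using Suc.prems unfolding s_def by linarith+
  have white: "measure_pmf.expectation (polya_urn_draws m n (w + m) b)
      (\<lambda>cs. real (count_list (White # cs) White) * real (count_list (White # cs) Black)) =
    real n * real b / (s + real m) +
    real n * (real n - 1) * ((real w + real m) * real b / ((s + real m) * (s + 2 * real m)))"
  proof -
    have "0 < w + m + b" using Suc.prems by linarith
    from Suc.IH[OF this] expectation_black[OF this] integrable_polya[OF this] show ?thesis
      by (simp add: distrib_right[of _ 1] distrib_right[of 1] s_def add_ac)
  qed
  have black: "measure_pmf.expectation (polya_urn_draws m n w (b + m))
      (\<lambda>cs. real (count_list (Black # cs) White) * real (count_list (Black # cs) Black)) =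
    real n * real w / (s + real m) +
    real n * (real n - 1) * (real w * (real b + real m) / ((s + real m) * (s + 2 * real m)))"
  proof -
    have "0 < w + (b + m)" using Suc.prems by linarith
    from Suc.IH[OF this] expectation_white[OF this] integrable_polya[OF this] show ?thesis
      by (simp add: distrib_left[of _ 1] distrib_left[of _ _ 1] s_def add_ac)
  qed
  have "(real w * (real n * real b / (s + real m) +
        real n * (real n - 1) * ((real w + real m) * real b / ((s + real m) * (s + 2 * real m)))) +
      real b * (real n * real w / (s + real m) +
        real n * (real n - 1) * (real w * (real b + real m) / ((s + real m) * (s + 2 * real m))))) / s =
    (2 * real n + real n * (real n - 1) * ((real w + real m + (real b + real m)) / (s + 2 * real m))) *
      (real w * real b / (s * (s + real m)))"
    using pos by (simp add: divide_simps) algebra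
  also have "(real w + real m + (real b + real m)) / (s + 2 * real m) = 1"
    using pos by (simp add: s_def)
  finally show ?case
    using Suc.prems
    by (subst expectation_polya_Suc) (simp_all only: white black, simp_all add: s_def algebra_simps)
qed simp

lemma expectation_hump_polya:
  assumes "0 < w + b" "0 < n"
  shows "measure_pmf.expectation (polya_urn_draws m n w b)
      (\<lambda>cs. clamped_hump (real (count_list cs White) / real n)) =
    (1 - 1 / real n) * (real w * real b / (real (w + b) * real (w + b + m)))"
proof -
  have "measure_pmf.expectation (polya_urn_draws m n w b)
      (\<lambda>cs. clamped_hump (real (count_list cs White) / real n)) =
    measure_pmf.expectation (polya_urn_draws m n w b)
      (\<lambda>cs. real (count_list cs White) * real (count_list cs Black) / (real n)\<^sup>2)"
  proof (rule integral_cong_AE)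
    show "AE cs in measure_pmf (polya_urn_draws m n w b).
        clamped_hump (real (count_list cs White) / real n) =
        real (count_list cs White) * real (count_list cs Black) / (real n)\<^sup>2"
    proof (rule AE_pmfI)
      fix cs assume "cs \<in> set_pmf (polya_urn_draws m n w b)"
      then have n: "n = count_list cs White + count_list cs Black"
        by (simp add: count_colours length_polya)
      have "clamped_hump (real (count_list cs White) / real n) =
          real (count_list cs White) / n * (1 - real (count_list cs White) / n)"
        using \<open>0 < n\<close> by (intro clamped_hump_unit_interval) (auto simp: n)
      also have "1 - real (count_list cs White) / n = real (count_list cs Black) / n"
      proof -
        have "real (count_list cs White) = real n - real (count_list cs Black)"
          by (simp add: n)
        then show ?thesis
          using \<open>0 < n\<close> by (simp only:) (simp add: field_simps)
      qed
      finally show "clamped_hump (real (count_list cs White) / real n) =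
          real (count_list cs White) * real (count_list cs Black) / (real n)\<^sup>2"
        by (simp add: power2_eq_square)
    qed
  qed simp_all
  also have "\<dots> = real n * (real n - 1) / (real n)\<^sup>2 *
      (real w * real b / (real (w + b) * real (w + b + m)))"
    using assms(1) by (simp add: expectation_white_times_black)
  also have "real n * (real n - 1) / (real n)\<^sup>2 = 1 - 1 / real n"
    using \<open>0 < n\<close> by (simp add: power2_eq_square field_simps)
  finally show ?thesis .
qed

section \<open>The Beta distribution\<close>

lemma Beta_plus1_plus1_both:
  fixes a b :: real
  assumes "a > 0" "b > 0"
  shows "Beta (a + 1) (b + 1) = a * b / ((a + b) * (a + b + 1)) * Beta a b"
proof -
  have "a \<notin> \<int>\<^sub>\<le>\<^sub>0" "b \<notin> \<int>\<^sub>\<le>\<^sub>0"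
    using assms by (auto elim!: nonpos_Ints_cases)
  then have "(a + b) * Beta a (b + 1) = b * Beta a b"
    and "(a + (b + 1)) * Beta (a + 1) (b + 1) = a * Beta a (b + 1)"
    by (auto intro: Beta_plus1_right Beta_plus1_left)
  then have "Beta a (b + 1) = b * Beta a b / (a + b)"
    and "Beta (a + 1) (b + 1) = a * Beta a (b + 1) / (a + b + 1)"
    using assms by (auto simp: field_simps)
  then show ?thesis by (simp add: mult_ac)
qed

lemma Beta_real_pos: "a > 0 \<Longrightarrow> b > 0 \<Longrightarrow> Beta a b > (0 :: real)"
  by (simp add: Beta_def Gamma_real_pos)

lemma beta_density_nonneg: "a > 0 \<Longrightarrow> b > 0 \<Longrightarrow> 0 \<le> beta_density a b x"
  using Beta_real_pos[of a b] by (simp add: beta_density_def)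

lemma integral_lborel_Beta:
  fixes a b :: real
  assumes "a > 0" "b > 0"
  shows "(\<integral>x. indicator {0..1} x * (x powr (a - 1) * (1 - x) powr (b - 1)) \<partial>lborel) = Beta a b"
proof -
  let ?f = "\<lambda>x::real. indicator {0..1} x * (x powr (a - 1) * (1 - x) powr (b - 1))"
  have "?f = (\<lambda>x. if x \<in> {0..1} then x powr (a - 1) * (1 - x) powr (b - 1) else 0)"
    by (auto simp: indicator_def)
  with has_integral_Beta_real[OF assms] have "(?f has_integral Beta a b) UNIV"
    by (simp only: has_integral_restrict_UNIV)
  then have "(\<integral>\<^sup>+x. ennreal (?f x) \<partial>lborel) = ennreal (Beta a b)"
    by (intro nn_integral_has_integral_lborel) auto
  then show ?thesis
    using Beta_real_pos[OF assms] by (subst integral_eq_nn_integral) auto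
qed

text \<open>Multiplying by \<open>x (1 - x)\<close> raises both exponents of the density by one, so that only the
  normalisation changes.\<close>

lemma integral_beta_density_hump:
  assumes "a > 0" "b > 0"
  shows "(\<integral>x. beta_density a b x * clamped_hump x \<partial>lborel) = a * b / ((a + b) * (a + b + 1))"
proof -
  have "beta_density a b x * clamped_hump x =
      indicator {0..1} x * (x powr (a + 1 - 1) * (1 - x) powr (b + 1 - 1)) / Beta a b" for x
  proof (cases "x \<in> {0..1}")
    case True
    then have "x * x powr (a - 1) = x powr a" "(1 - x) * (1 - x) powr (b - 1) = (1 - x) powr b"
      by (simp_all add: powr_mult_base)
    then have "x powr a * (1 - x) powr b =
        x powr (a - 1) * (1 - x) powr (b - 1) * (x * (1 - x))"
      by (metis mult.assoc mult.commute)
    with True show ?thesis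
      by (simp add: beta_density_def clamped_hump_unit_interval)
  qed (simp only: beta_density_def, simp)
  then have "(\<integral>x. beta_density a b x * clamped_hump x \<partial>lborel) =
      Beta (a + 1) (b + 1) / Beta a b"
    using integral_lborel_Beta[of "a + 1" "b + 1"] assms by simp
  with Beta_real_pos[OF assms] show ?thesis
    by (simp add: Beta_plus1_plus1_both assms)
qed

section \<open>The lower bound\<close>

lemma wasserstein_dist_ge:
  assumes "1-lipschitz_on UNIV h"
  shows "ereal \<bar>(LINT \<omega>|M. h (X \<omega>)) - (LINT \<omega>|N. h (Y \<omega>))\<bar> \<le> wasserstein_dist M X N Y"
  unfolding wasserstein_dist_def using assms by (intro SUP_upper) simp

theorem mainTheorem3:
  fixes \<alpha> \<beta> m n :: nat
    and M :: "'a measure" and D :: "'a \<Rightarrow> colour list" and S :: "'a \<Rightarrow> nat" and W :: "'a \<Rightarrow> real"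
    and N :: "'b measure" and Z :: "'b \<Rightarrow> real"
  assumes "\<alpha> \<ge> 1" and "\<beta> \<ge> 1" and "m \<ge> 1" and "n \<ge> 1"
    and "prob_space M" and "prob_space N"
    and "D \<in> measurable M (count_space UNIV)"
    and "distr M (count_space UNIV) D = measure_pmf (polya_urn_draws m n \<alpha> \<beta>)"
    and "\<And>\<omega>. S \<omega> = count_list (D \<omega>) White"
    and "\<And>\<omega>. W \<omega> = real (S \<omega>) / real n"
    and "distributed N lborel Z (beta_density (real \<alpha> / real m) (real \<beta> / real m))"
  shows "wasserstein_dist M W N Z \<ge>
    ereal (1 / real n * (real \<alpha> * real \<beta> / ((real \<alpha> + real \<beta> + real m) * (real \<alpha> + real \<beta>))))"
proof -
  define q where "q = real \<alpha> * real \<beta> / ((real \<alpha> + real \<beta> + real m) * (real \<alpha> + real \<beta>))"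
  define a b where "a = real \<alpha> / real m" and "b = real \<beta> / real m"
  have ab: "a > 0" "b > 0"
    using assms(1-3) by (simp_all add: a_def b_def)
  have "(LINT \<omega>|M. clamped_hump (W \<omega>)) =
      (LINT cs|distr M (count_space UNIV) D. clamped_hump (real (count_list cs White) / real n))"
    by (simp add: assms(9,10) integral_distr[OF assms(7)])
  also have "\<dots> = (1 - 1 / real n) * q"
    using assms(1,4) by (simp add: assms(8) expectation_hump_polya q_def mult_ac)
  finally have W: "(LINT \<omega>|M. clamped_hump (W \<omega>)) = (1 - 1 / real n) * q" .
  have "(LINT \<omega>|N. clamped_hump (Z \<omega>)) = (\<integral>x. beta_density a b x * clamped_hump x \<partial>lborel)"
    using assms(11) beta_density_nonneg[OF ab] unfolding a_def b_def
    by (intro distributed_integral[symmetric]) auto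
  also have "\<dots> = a * b / ((a + b) * (a + b + 1))"
    by (rule integral_beta_density_hump[OF ab])
  also have "\<dots> = q"
  proof -
    have "a + b = (real \<alpha> + real \<beta>) / m" "a + b + 1 = (real \<alpha> + real \<beta> + real m) / m"
      using assms(3) by (simp_all add: a_def b_def field_simps)
    then show ?thesis
      using assms(3) by (simp add: a_def b_def q_def mult_ac)
  qed
  finally have Z: "(LINT \<omega>|N. clamped_hump (Z \<omega>)) = q" .
  have "0 \<le> q" by (simp add: q_def)
  then have "\<bar>(LINT \<omega>|M. clamped_hump (W \<omega>)) - (LINT \<omega>|N. clamped_hump (Z \<omega>))\<bar> = 1 / real n * q"
    unfolding W Z by (simp add: algebra_simps)
  with wasserstein_dist_ge[OF lipschitz_clamped_hump, of M W N Z] show ?thesis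
    by (simp add: q_def)
qed

end
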